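(* Suppose $\kappa$ is weakly compact. Let $\sigma,\delta>0$ be ordinals and assume $\delta,\sigma<\kappa$. Then $\mathrm{SDHL}'(\delta,\sigma,\kappa)$ holds if and only if $\mathrm{SDHL}(\delta,\sigma,\kappa)$ holds.
   Context: A cardinal $\kappa$ is weakly compact if it is strongly inaccessible and every $\kappa$-tree has a cofinal branch. A tree $T\subseteq {}^{<\kappa}\kappa$ is a set of sequences closed under initial segments, ordered by end-extension $\sqsubseteq$; $T(\zeta):=T\cap{}^{\zeta}\kappa$ is its $\zeta$-th level. "Successor" of a node always means immediate successor. $T$ is a $\kappa$-tree if $|T|=\kappa$ and every level of $T$ has cardinality less than $\kappa$. $T$ is perfect if every node of $T$ has an extension in $T$ which splits in $T$. $T\subseteq{}^{<\kappa}\kappa$ is regular if it is a perfect $\kappa$-tree in which every maximal branch has cofinality $\kappa$. $\mathrm{Cone}(t):=\{s\in{}^{<\kappa}\kappa:s\sqsupseteq t\}$. $X\subseteq{}^{<\kappa}\kappa$ dominates $Y\subseteq{}^{<\kappa}\kappa$ if $(\forall y\in Y)(\exists x\in X)\ y\sqsubseteq x$. Level-product: for an ordinal $\delta>0$ and $X_i\subseteq{}^{<\kappa}\kappa$ ($i<\delta$), with $X_i(\zeta):=X_i\cap{}^{\zeta}\kappa$, $\bigotimes_{i<\delta}X_i:=\{\langle x_i:i<\delta\rangle:(\exists\zeta<\kappa)(\forall i<\delta)\ x_i\in X_i(\zeta)\}$. $\mathrm{SDHL}(\delta,\sigma,\kappa)$ is the statement: given any sequence $\langle T_i\subseteq{}^{<\kappa}\kappa:i<\delta\rangle$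 of regular trees and any coloring $c:\bigotimes_{i<\delta}T_i\to\sigma$, there exist $\zeta<\zeta'<\kappa$, $\langle t_i\in T_i(\zeta):i<\delta\rangle$, and $\langle X_i\subseteq T_i(\zeta'):i<\delta\rangle$ such that each $X_i$ dominates $T_i(\zeta+1)\cap\mathrm{Cone}(t_i)$ and $|c[\bigotimes_{i<\delta}X_i]|=1$. A somewhere dense matrix for a sequence of regular trees $\langle T_i:i<\delta\rangle$ is a sequence of sets $\langle X_i\subseteq T_i:i<\delta\rangle$ such that there are nodes $t_i\in T_i$ ($i<\delta$), all of the same length, such that each $X_i$ dominates the set of all successors of $t_i$ in $T_i$. $\mathrm{SDHL}'(\delta,\sigma,\kappa)$ is the statement: for any sequence $\langle T_i\subseteq{}^{<\kappa}\kappa:i<\delta\rangle$ of regular trees, any coloring $c:\prod_{i<\delta}T_i\to\sigma$ of the full product is constant on $\prod_{i<\delta}X_i$ for some somewhere dense matrix $\langle X_i\subseteq T_i:i<\delta\rangle$. *)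

theory Defs
  imports Main "HOL-Library.FuncSet"
begin

unbundle cardinal_syntax

text \<open>
  Ordinals are well-order relations, compared by \<open><o\<close>; the ordinal \<open>\<alpha>\<close>, viewed as the set
  of all smaller ordinals, is \<open>Field \<alpha>\<close>, and the ordinal \<open>0\<close> is the empty relation.
  In particular, for a cardinal \<open>\<kappa>\<close> the ordinals \<open>\<zeta> < \<kappa>\<close> are the elements of \<open>Field \<kappa>\<close>,
  and \<open>\<zeta>\<close> as a set is \<open>underS \<kappa> \<zeta>\<close>.

  A sequence of length \<open>\<zeta>\<close> is a partial map with domain \<open>underS \<kappa> \<zeta>\<close>, so that end-extension
  of sequences is \<open>map_le\<close>.
\<close>

definition ord_suc :: "'a rel \<Rightarrow> 'a \<Rightarrow> 'a" where
  "ord_suc \<kappa> \<zeta> = wo_rel.suc \<kappa> {\<zeta>}"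

definition strongly_inaccessible :: "'a rel \<Rightarrow> bool" where
  "strongly_inaccessible \<kappa> \<longleftrightarrow>
     Card_order \<kappa> \<and> natLeq <o \<kappa> \<and> regularCard \<kappa> \<and>
     (\<forall>\<mu> :: 'a rel. Card_order \<mu> \<and> \<mu> <o \<kappa> \<longrightarrow> ctwo ^c \<mu> <o \<kappa>)"

definition seqs_of_length :: "'a rel \<Rightarrow> 'a \<Rightarrow> ('a \<rightharpoonup> 'a) set" where
  "seqs_of_length \<kappa> \<zeta> = {s. dom s = underS \<kappa> \<zeta> \<and> ran s \<subseteq> Field \<kappa>}"

definition seqs :: "'a rel \<Rightarrow> ('a \<rightharpoonup> 'a) set" where
  "seqs \<kappa> = (\<Union>\<zeta>\<in>Field \<kappa>. seqs_of_length \<kappa> \<zeta>)"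

definition level :: "'a rel \<Rightarrow> ('a \<rightharpoonup> 'a) set \<Rightarrow> 'a \<Rightarrow> ('a \<rightharpoonup> 'a) set" where
  "level \<kappa> X \<zeta> = X \<inter> seqs_of_length \<kappa> \<zeta>"

definition Cone :: "'a rel \<Rightarrow> ('a \<rightharpoonup> 'a) \<Rightarrow> ('a \<rightharpoonup> 'a) set" where
  "Cone \<kappa> t = {s \<in> seqs \<kappa>. t \<subseteq>\<^sub>m s}"

definition dominates :: "('a \<rightharpoonup> 'a) set \<Rightarrow> ('a \<rightharpoonup> 'a) set \<Rightarrow> bool" where
  "dominates X Y \<longleftrightarrow> (\<forall>y\<in>Y. \<exists>x\<in>X. y \<subseteq>\<^sub>m x)"

definition seq_tree :: "'a rel \<Rightarrow> ('a \<rightharpoonup> 'a) set \<Rightarrow> bool" where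
  "seq_tree \<kappa> T \<longleftrightarrow>
     T \<subseteq> seqs \<kappa> \<and> (\<forall>t\<in>T. \<forall>s\<in>seqs \<kappa>. s \<subseteq>\<^sub>m t \<longrightarrow> s \<in> T)"

definition kappa_tree :: "'a rel \<Rightarrow> ('a \<rightharpoonup> 'a) set \<Rightarrow> bool" where
  "kappa_tree \<kappa> T \<longleftrightarrow>
     seq_tree \<kappa> T \<and> |T| =o \<kappa> \<and> (\<forall>\<zeta>\<in>Field \<kappa>. |level \<kappa> T \<zeta>| <o \<kappa>)"

definition successors :: "('a \<rightharpoonup> 'a) set \<Rightarrow> ('a \<rightharpoonup> 'a) \<Rightarrow> ('a \<rightharpoonup> 'a) set" where
  "successors T t =
     {s \<in> T. t \<subseteq>\<^sub>m s \<and> t \<noteq> s \<and>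
        \<not> (\<exists>u\<in>T. t \<subseteq>\<^sub>m u \<and> u \<subseteq>\<^sub>m s \<and> u \<noteq> t \<and> u \<noteq> s)}"

definition splits :: "('a \<rightharpoonup> 'a) set \<Rightarrow> ('a \<rightharpoonup> 'a) \<Rightarrow> bool" where
  "splits T t \<longleftrightarrow> (\<exists>u\<in>successors T t. \<exists>v\<in>successors T t. u \<noteq> v)"

definition perfect_tree :: "('a \<rightharpoonup> 'a) set \<Rightarrow> bool" where
  "perfect_tree T \<longleftrightarrow> (\<forall>t\<in>T. \<exists>s\<in>T. t \<subseteq>\<^sub>m s \<and> splits T s)"

definition maximal_branch :: "('a \<rightharpoonup> 'a) set \<Rightarrow> ('a \<rightharpoonup> 'a) set \<Rightarrow> bool" where
  "maximal_branch T B \<longleftrightarrow> pred_on.maxchain T (\<subseteq>\<^sub>m) B"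

text \<open>
  The library's \<open>cofinal\<close> asks for strictly larger elements, so no set is cofinal in an order with
  a greatest element. Here cofinality is the usual one: a branch with a last node has cofinality 1.
\<close>

definition branch_cofinality :: "('a \<rightharpoonup> 'a) set \<Rightarrow> 'a rel \<Rightarrow> bool" where
  "branch_cofinality B \<mu> \<longleftrightarrow>
     (\<exists>C\<subseteq>B. dominates C B \<and> |C| =o \<mu>) \<and> (\<forall>C\<subseteq>B. dominates C B \<longrightarrow> \<mu> \<le>o |C| )"

definition regular_tree :: "'a rel \<Rightarrow> ('a \<rightharpoonup> 'a) set \<Rightarrow> bool" where
  "regular_tree \<kappa> T \<longleftrightarrow>
     kappa_tree \<kappa> T \<and> perfect_tree T \<and> (\<forall>B. maximal_branch T B \<longrightarrow> branch_cofinality B \<kappa>)"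

definition cofinal_branch :: "'a rel \<Rightarrow> ('a \<rightharpoonup> 'a) set \<Rightarrow> ('a \<rightharpoonup> 'a) set \<Rightarrow> bool" where
  "cofinal_branch \<kappa> T B \<longleftrightarrow>
     maximal_branch T B \<and> (\<forall>\<zeta>\<in>Field \<kappa>. B \<inter> level \<kappa> T \<zeta> \<noteq> {})"

definition weakly_compact :: "'a rel \<Rightarrow> bool" where
  "weakly_compact \<kappa> \<longleftrightarrow>
     strongly_inaccessible \<kappa> \<and> (\<forall>T. kappa_tree \<kappa> T \<longrightarrow> (\<exists>B. cofinal_branch \<kappa> T B))"

definition level_product ::
    "'a rel \<Rightarrow> 'd rel \<Rightarrow> ('d \<Rightarrow> ('a \<rightharpoonup> 'a) set) \<Rightarrow> ('d \<Rightarrow> ('a \<rightharpoonup> 'a)) set" where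
  "level_product \<kappa> \<delta> X = (\<Union>\<zeta>\<in>Field \<kappa>. \<Pi>\<^sub>E i\<in>Field \<delta>. level \<kappa> (X i) \<zeta>)"

definition SDHL :: "'d rel \<Rightarrow> 's rel \<Rightarrow> 'a rel \<Rightarrow> bool" where
  "SDHL \<delta> \<sigma> \<kappa> \<longleftrightarrow>
     (\<forall>T c. (\<forall>i\<in>Field \<delta>. regular_tree \<kappa> (T i)) \<and> c \<in> level_product \<kappa> \<delta> T \<rightarrow> Field \<sigma> \<longrightarrow>
        (\<exists>\<zeta>\<in>Field \<kappa>. \<exists>\<zeta>'\<in>Field \<kappa>. \<zeta> \<in> underS \<kappa> \<zeta>' \<and>
          (\<exists>t X. (\<forall>i\<in>Field \<delta>. t i \<in> level \<kappa> (T i) \<zeta>) \<and>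
                 (\<forall>i\<in>Field \<delta>. X i \<subseteq> level \<kappa> (T i) \<zeta>') \<and>
                 (\<forall>i\<in>Field \<delta>. dominates (X i) (level \<kappa> (T i) (ord_suc \<kappa> \<zeta>) \<inter> Cone \<kappa> (t i))) \<and>
                 card (c ` level_product \<kappa> \<delta> X) = 1)))"

definition somewhere_dense_matrix ::
    "'a rel \<Rightarrow> 'd rel \<Rightarrow> ('d \<Rightarrow> ('a \<rightharpoonup> 'a) set) \<Rightarrow> ('d \<Rightarrow> ('a \<rightharpoonup> 'a) set) \<Rightarrow> bool" where
  "somewhere_dense_matrix \<kappa> \<delta> T X \<longleftrightarrow>
     (\<forall>i\<in>Field \<delta>. X i \<subseteq> T i) \<and>
     (\<exists>t. (\<exists>\<zeta>\<in>Field \<kappa>. \<forall>i\<in>Field \<delta>. t i \<in> level \<kappa> (T i) \<zeta>) \<and>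
          (\<forall>i\<in>Field \<delta>. dominates (X i) (successors (T i) (t i))))"

definition SDHL' :: "'d rel \<Rightarrow> 's rel \<Rightarrow> 'a rel \<Rightarrow> bool" where
  "SDHL' \<delta> \<sigma> \<kappa> \<longleftrightarrow>
     (\<forall>T c. (\<forall>i\<in>Field \<delta>. regular_tree \<kappa> (T i)) \<and> c \<in> (\<Pi>\<^sub>E i\<in>Field \<delta>. T i) \<rightarrow> Field \<sigma> \<longrightarrow>
        (\<exists>X. somewhere_dense_matrix \<kappa> \<delta> T X \<and>
             (\<exists>k\<in>Field \<sigma>. \<forall>x\<in>(\<Pi>\<^sub>E i\<in>Field \<delta>. X i). c x = k)))"

end

theory Submission
  imports Defs
begin

text \<open>
  Only the passage from \<open>SDHL'\<close> to \<open>SDHL\<close> needs weak compactness. In a regular tree every node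
  has comparable nodes on all levels, so a tuple \<open>x\<close> of nodes of arbitrary lengths can be moved
  to a tuple on level \<open>\<zeta>\<close>, for each \<open>\<zeta> < \<kappa>\<close>. There are at most \<open>\<kappa>\<close> such \<open>x\<close>, so the colours
  that level \<open>\<zeta>\<close> assigns to them form a \<open>\<kappa>\<close>-sequence in \<open>\<sigma>\<close>, and the initial segments of these
  sequences form a \<open>\<kappa>\<close>-tree. A cofinal branch is a colouring \<open>g\<close> of the full product which, on any
  fewer than \<open>\<kappa>\<close> tuples, agrees with arbitrarily high levels. A matrix on which \<open>g\<close> is constant can
  be thinned to size less than \<open>\<kappa>\<close> and then lifted to one such level.
\<close>

section \<open>Comparing partial maps through their domains\<close>

lemma map_le_same_dom: "s \<subseteq>\<^sub>m t \<Longrightarrow> dom t \<subseteq> dom s \<Longrightarrow> s = t"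
  by (metis map_le_antisym map_le_def subset_iff)

lemma map_le_common_bound: "s \<subseteq>\<^sub>m u \<Longrightarrow> t \<subseteq>\<^sub>m u \<Longrightarrow> dom s \<subseteq> dom t \<Longrightarrow> s \<subseteq>\<^sub>m t"
  unfolding map_le_def by (metis subset_iff)

section \<open>Cardinal arithmetic below an inaccessible cardinal\<close>

locale inaccessible =
  fixes \<kappa> :: "'a rel"
  assumes inaccessible: "strongly_inaccessible \<kappa>"
begin

lemma Card_order: "Card_order \<kappa>"
  and regularCard: "regularCard \<kappa>"
  using inaccessible unfolding strongly_inaccessible_def by auto

lemma Well_order: "Well_order \<kappa>"
  using Card_order card_order_on_well_order_on by blast

sublocale wo: wo_rel \<kappa>
  using Well_order by unfold_locales

lemma infinite_Field: "\<not> finite (Field \<kappa>)"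
proof -
  have "natLeq \<le>o \<kappa>"
    using inaccessible ordLess_imp_ordLeq unfolding strongly_inaccessible_def by blast
  then show ?thesis
    using Card_order cinfinite_mono natLeq_cinfinite unfolding cinfinite_def by blast
qed

lemma stable: "stable \<kappa>"
  by (rule regularCard_stable[OF Card_order infinite_Field regularCard])

lemma card_Field: "|Field \<kappa>| =o \<kappa>"
  by (rule card_of_Field_ordIso[OF Card_order])

lemma finite_small: "finite A \<Longrightarrow> |A| <o \<kappa>"
  by (rule finite_ordLess_infinite[OF card_of_Well_order Well_order])
    (simp_all add: infinite_Field Field_card_of)

lemma subset_small: "A \<subseteq> B \<Longrightarrow> |B| <o \<kappa> \<Longrightarrow> |A| <o \<kappa>"
  by (rule ordLeq_ordLess_trans[OF card_of_mono1])

lemma image_small: "|A| <o \<kappa> \<Longrightarrow> |f ` A| <o \<kappa>"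
  by (rule ordLeq_ordLess_trans[OF card_of_image])

lemma underS_small: "\<zeta> \<in> Field \<kappa> \<Longrightarrow> |underS \<kappa> \<zeta>| <o \<kappa>"
  by (rule card_of_underS[OF Card_order])

lemma Un_small: "|A| <o \<kappa> \<Longrightarrow> |B| <o \<kappa> \<Longrightarrow> |A \<union> B| <o \<kappa>"
  by (rule card_of_Un_ordLess_infinite_Field[OF infinite_Field Card_order])

text \<open>The strong limit clause of \<open>strongly_inaccessible\<close> speaks only of cardinals
  on the type of \<kappa>, whereas \<open>A\<close> may have any type. Hence \<open>A\<close> is
  first replaced by an equinumerous set \<open>B\<close> of that type.\<close>

lemma Pow_small:
  assumes "|A| <o \<kappa>"
  shows "|Pow A| <o \<kappa>"
proof -
  obtain B :: "'a set" where B: "|A| =o |B|" "|B| <o \<kappa>"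
    using internalize_card_of_ordLess[THEN iffD1, OF assms] by metis
  have "\<forall>\<mu> :: 'a rel. Card_order \<mu> \<and> \<mu> <o \<kappa> \<longrightarrow> ctwo ^c \<mu> <o \<kappa>"
    using inaccessible unfolding strongly_inaccessible_def by simp
  then have "ctwo ^c |B| <o \<kappa>"
    using B(2) card_of_Card_order by blast
  moreover have "|Pow B| =o ctwo ^c |B|"
    unfolding ctwo_def cexp_def Field_card_of by (rule card_of_Pow_Func)
  moreover have "|Pow A| =o |Pow B|"
  proof -
    obtain h where "bij_betw h A B"
      using B(1) card_of_ordIso by metis
    then have "bij_betw (image h) (Pow A) (Pow B)"
      by (rule bij_betw_Pow)
    then show ?thesis
      using card_of_ordIso by blast
  qed
  ultimately show ?thesis
    by (metis ordIso_ordLess_trans)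
qed

text \<open>A function in the product is determined by its graph, a subset of the disjoint sum of
  the \<open>A i\<close>. Regularity keeps this sum below \<kappa>, and the strong limit property
  then does so for its power set.\<close>

lemma PiE_small:
  assumes "|I| <o \<kappa>" and "\<And>i. i \<in> I \<Longrightarrow> |A i| <o \<kappa>"
  shows "|\<Pi>\<^sub>E i\<in>I. A i| <o \<kappa>"
proof -
  have "|Pow (SIGMA i:I. A i)| <o \<kappa>"
    using stable_elim[OF stable assms] by (rule Pow_small)
  moreover have "|\<Pi>\<^sub>E i\<in>I. A i| \<le>o |Pow (SIGMA i:I. A i)|"
  proof -
    let ?graph = "\<lambda>x. (\<lambda>i. (i, x i)) ` I"
    have "inj_on ?graph (\<Pi>\<^sub>E i\<in>I. A i)"
    proof (rule inj_onI)
      fix x y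
      assume "x \<in> (\<Pi>\<^sub>E i\<in>I. A i)" "y \<in> (\<Pi>\<^sub>E i\<in>I. A i)" and "?graph x = ?graph y"
      moreover from this(3) have "x i = y i" if "i \<in> I" for i
        using that by blast
      ultimately show "x = y"
        by (meson PiE_ext)
    qed
    moreover have "?graph ` (\<Pi>\<^sub>E i\<in>I. A i) \<subseteq> Pow (SIGMA i:I. A i)"
      by auto
    ultimately show ?thesis
      using card_of_ordLeq by blast
  qed
  ultimately show ?thesis
    by (metis ordLeq_ordLess_trans)
qed

section \<open>Successors and bounds in \<kappa>\<close>

lemma ord_suc:
  assumes "\<zeta> \<in> Field \<kappa>"
  shows ord_suc_in_Field: "ord_suc \<kappa> \<zeta> \<in> Field \<kappa>"
    and underS_ord_suc: "underS \<kappa> (ord_suc \<kappa> \<zeta>) = insert \<zeta> (underS \<kappa> \<zeta>)"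
proof -
  \<comment> \<open>An infinite cardinal is a limit ordinal, so \<zeta> has a strict upper bound in
    the field and \<open>wo_rel.suc\<close> yields a genuine successor.\<close>
  obtain b where b: "b \<in> Field \<kappa>" "\<zeta> \<noteq> b" "(\<zeta>, b) \<in> \<kappa>"
    using infinite_Card_order_limit[OF Card_order infinite_Field assms] by blast
  then have ne: "AboveS \<kappa> {\<zeta>} \<noteq> {}"
    unfolding AboveS_def by auto
  have sub: "{\<zeta>} \<subseteq> Field \<kappa>"
    using assms by simp
  show F: "ord_suc \<kappa> \<zeta> \<in> Field \<kappa>"
    unfolding ord_suc_def using wo.suc_inField sub ne by blast
  have gr: "ord_suc \<kappa> \<zeta> \<noteq> \<zeta>" "(\<zeta>, ord_suc \<kappa> \<zeta>) \<in> \<kappa>"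
    unfolding ord_suc_def using wo.suc_greater sub ne by blast+
  show "underS \<kappa> (ord_suc \<kappa> \<zeta>) = insert \<zeta> (underS \<kappa> \<zeta>)"
  proof (intro equalityI subsetI)
    fix x
    assume x: "x \<in> underS \<kappa> (ord_suc \<kappa> \<zeta>)"
    then have xF: "x \<in> Field \<kappa>"
      by (auto simp: underS_def Field_def)
    have "x \<notin> AboveS \<kappa> {\<zeta>}"
    proof
      assume "x \<in> AboveS \<kappa> {\<zeta>}"
      then have "(ord_suc \<kappa> \<zeta>, x) \<in> \<kappa>"
        unfolding ord_suc_def by (rule wo.suc_least_AboveS)
      then show False
        using x wo.ANTISYM unfolding underS_def antisym_def by blast
    qed
    then have "x = \<zeta> \<or> (\<zeta>, x) \<notin> \<kappa>"
      using xF unfolding AboveS_def by auto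
    then show "x \<in> insert \<zeta> (underS \<kappa> \<zeta>)"
      using wo.TOTALS xF assms unfolding underS_def by blast
  next
    fix x
    assume "x \<in> insert \<zeta> (underS \<kappa> \<zeta>)"
    then show "x \<in> underS \<kappa> (ord_suc \<kappa> \<zeta>)"
      using gr wo.TRANS wo.ANTISYM unfolding underS_def trans_def antisym_def by blast
  qed
qed

lemma bounded:
  assumes "K \<subseteq> Field \<kappa>" and "|K| <o \<kappa>"
  obtains a where "a \<in> Field \<kappa>" and "\<And>b. b \<in> K \<Longrightarrow> b \<in> underS \<kappa> a"
proof -
  have "\<not> |K| =o \<kappa>"
    using assms(2) not_ordLess_ordIso by blast
  then have "\<not> cofinal K \<kappa>"
    using regularCard assms(1) unfolding regularCard_def by blast
  then obtain a where a: "a \<in> Field \<kappa>" "\<And>b. b \<in> K \<Longrightarrow> a = b \<or> (a, b) \<notin> \<kappa>"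
    unfolding cofinal_def by blast
  \<comment> \<open>\<open>cofinal\<close> asks for strictly larger elements, so its failure leaves
    open that \<open>a\<close> belongs to \<open>K\<close>. Passing to the successor of
    \<open>a\<close> makes the bound strict.\<close>
  have "b \<in> underS \<kappa> (ord_suc \<kappa> a)" if "b \<in> K" for b
    using a that assms(1) wo.TOTALS underS_ord_suc[OF a(1)] unfolding underS_def by blast
  then show ?thesis
    using ord_suc_in_Field[OF a(1)] that by blast
qed

section \<open>Lengths of sequences, levels and nodes of trees\<close>

lemma underS_subset_iff:
  "\<zeta> \<in> Field \<kappa> \<Longrightarrow> \<eta> \<in> Field \<kappa> \<Longrightarrow> underS \<kappa> \<zeta> \<subseteq> underS \<kappa> \<eta> \<longleftrightarrow> (\<zeta>, \<eta>) \<in> \<kappa>"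
  by (rule underS_incl_iff[OF wo.LIN])

lemma underS_inject:
  "\<zeta> \<in> Field \<kappa> \<Longrightarrow> \<eta> \<in> Field \<kappa> \<Longrightarrow> underS \<kappa> \<zeta> = underS \<kappa> \<eta> \<longleftrightarrow> \<zeta> = \<eta>"
  by (metis antisymD equalityE underS_subset_iff wo.ANTISYM)

definition seq_length :: "('a \<rightharpoonup> 'a) \<Rightarrow> 'a" where
  "seq_length s = (THE \<zeta>. \<zeta> \<in> Field \<kappa> \<and> dom s = underS \<kappa> \<zeta>)"

lemma seq_length_eq:
  assumes "\<zeta> \<in> Field \<kappa>" and "s \<in> seqs_of_length \<kappa> \<zeta>"
  shows "seq_length s = \<zeta>"
  unfolding seq_length_def
  using assms underS_inject by (intro the_equality) (auto simp: seqs_of_length_def)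

lemma seq_length:
  assumes "s \<in> seqs \<kappa>"
  shows "seq_length s \<in> Field \<kappa>" and "s \<in> seqs_of_length \<kappa> (seq_length s)"
  using assms seq_length_eq unfolding seqs_def by auto

lemma dom_seq: "s \<in> seqs \<kappa> \<Longrightarrow> dom s = underS \<kappa> (seq_length s)"
  using seq_length(2) unfolding seqs_of_length_def by blast

lemma seq_tree_restrict:
  assumes "seq_tree \<kappa> T" and "s \<in> T" and "\<zeta> \<in> Field \<kappa>" and "underS \<kappa> \<zeta> \<subseteq> dom s"
  shows "s |` underS \<kappa> \<zeta> \<in> level \<kappa> T \<zeta>" and "s |` underS \<kappa> \<zeta> \<subseteq>\<^sub>m s"
proof -
  show le: "s |` underS \<kappa> \<zeta> \<subseteq>\<^sub>m s"
    by (auto simp: map_le_def)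
  have "s \<in> seqs \<kappa>"
    using assms(1,2) unfolding seq_tree_def by blast
  then have "ran s \<subseteq> Field \<kappa>"
    unfolding seqs_def seqs_of_length_def by auto
  then have len: "s |` underS \<kappa> \<zeta> \<in> seqs_of_length \<kappa> \<zeta>"
    using assms(4) unfolding seqs_of_length_def by (auto simp: ran_def restrict_map_def split: if_splits)
  then have "s |` underS \<kappa> \<zeta> \<in> seqs \<kappa>"
    using assms(3) unfolding seqs_def by blast
  then have "s |` underS \<kappa> \<zeta> \<in> T"
    using assms(1,2) le unfolding seq_tree_def by blast
  then show "s |` underS \<kappa> \<zeta> \<in> level \<kappa> T \<zeta>"
    using len unfolding level_def by blast
qed

text \<open>This identifies the sets to be dominated in \<open>SDHL'\<close> with those in
  \<open>SDHL\<close>. It rests on closure under initial segments: a proper extension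
  \<open>s\<close> of \<open>t\<close> can be cut at length \<zeta> + 1, the cut is a node strictly
  above \<open>t\<close>, and minimality of \<open>s\<close> makes it equal to the cut.\<close>

lemma successors_eq:
  assumes "seq_tree \<kappa> T" and "\<zeta> \<in> Field \<kappa>" and "t \<in> level \<kappa> T \<zeta>"
  shows "successors T t = level \<kappa> T (ord_suc \<kappa> \<zeta>) \<inter> Cone \<kappa> t"
proof (intro equalityI subsetI)
  have T: "T \<subseteq> seqs \<kappa>"
    using assms(1) unfolding seq_tree_def by blast
  have dt: "dom t = underS \<kappa> \<zeta>"
    using assms(3) unfolding level_def seqs_of_length_def by blast
  note suc = ord_suc_in_Field[OF assms(2)] underS_ord_suc[OF assms(2)]
  {
    fix s
    assume "s \<in> successors T t"
    then have s: "s \<in> T" "t \<subseteq>\<^sub>m s" "t \<noteq> s"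
      and min: "\<And>u. u \<in> T \<Longrightarrow> t \<subseteq>\<^sub>m u \<Longrightarrow> u \<subseteq>\<^sub>m s \<Longrightarrow> u \<noteq> t \<Longrightarrow> u = s"
      unfolding successors_def by auto
    have "\<not> underS \<kappa> (seq_length s) \<subseteq> underS \<kappa> \<zeta>"
      using map_le_same_dom[OF s(2)] s dt dom_seq T by auto
    then have "(\<zeta>, seq_length s) \<in> \<kappa>" "\<zeta> \<noteq> seq_length s"
      using wo.TOTALS underS_subset_iff assms(2) seq_length(1) s(1) T by blast+
    then have "\<zeta> \<in> underS \<kappa> (seq_length s)"
      unfolding underS_def by blast
    moreover have "underS \<kappa> \<zeta> \<subseteq> dom s"
      using dt s(2) map_le_implies_dom_le by blast
    moreover have "dom s = underS \<kappa> (seq_length s)"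
      using s(1) T by (intro dom_seq) blast
    ultimately have sub: "underS \<kappa> (ord_suc \<kappa> \<zeta>) \<subseteq> dom s"
      using suc(2) by simp
    let ?u = "s |` underS \<kappa> (ord_suc \<kappa> \<zeta>)"
    note u = seq_tree_restrict[OF assms(1) s(1) suc(1) sub]
    have du: "dom ?u = insert \<zeta> (underS \<kappa> \<zeta>)"
      using sub suc(2) by auto
    have "t \<subseteq>\<^sub>m ?u"
      using map_le_common_bound[OF s(2) u(2)] dt du by auto
    moreover have "?u \<noteq> t"
      using du dt underS_notIn[of \<zeta> \<kappa>] by blast
    ultimately have "?u = s"
      using min u unfolding level_def by blast
    then show "s \<in> level \<kappa> T (ord_suc \<kappa> \<zeta>) \<inter> Cone \<kappa> t"
      using u(1) s T unfolding Cone_def by auto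
  next
    fix s
    assume "s \<in> level \<kappa> T (ord_suc \<kappa> \<zeta>) \<inter> Cone \<kappa> t"
    then have s: "s \<in> T" "t \<subseteq>\<^sub>m s" "dom s = insert \<zeta> (underS \<kappa> \<zeta>)"
      using suc(2) unfolding level_def Cone_def seqs_of_length_def by auto
    have "u = t \<or> u = s" if u: "u \<in> T" "t \<subseteq>\<^sub>m u" "u \<subseteq>\<^sub>m s" for u
    proof -
      have "underS \<kappa> \<zeta> \<subseteq> dom u" "dom u \<subseteq> insert \<zeta> (underS \<kappa> \<zeta>)"
        using map_le_implies_dom_le u(2,3) dt s(3) by blast+
      then have "dom u \<subseteq> dom t \<or> dom s \<subseteq> dom u"
        unfolding dt s(3) by (cases "\<zeta> \<in> dom u") (simp_all add: subset_insert)
      then show ?thesis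
        using map_le_same_dom[OF u(2)] map_le_same_dom[OF u(3)] by blast
    qed
    moreover have "t \<noteq> s"
      using s(3) dt underS_notIn[of \<zeta> \<kappa>] by blast
    ultimately show "s \<in> successors T t"
      using s unfolding successors_def by blast
  }
qed

text \<open>A maximal branch through \<open>t\<close> has cofinality \<kappa> and hence at least
  \<kappa> nodes. Along a branch the length determines the node, so fewer than \<kappa> of them have
  length below \<zeta>, and some node is long enough to be cut at \<zeta>.\<close>

lemma regular_tree_comparable_node:
  assumes "regular_tree \<kappa> T" and "t \<in> T" and "\<zeta> \<in> Field \<kappa>"
  shows "\<exists>s \<in> level \<kappa> T \<zeta>. t \<subseteq>\<^sub>m s \<or> s \<subseteq>\<^sub>m t"
proof -
  have tree: "seq_tree \<kappa> T"
    using assms(1) unfolding regular_tree_def kappa_tree_def by blast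
  then have T: "T \<subseteq> seqs \<kappa>"
    unfolding seq_tree_def by blast
  \<comment> \<open>Hausdorff's principle is applied to the nodes comparable with \<open>t\<close>:
    since \<open>t\<close> can be added to any chain in \<open>A\<close>, a maximal chain in
    \<open>A\<close> must contain it.\<close>
  define A where "A = {s \<in> T. s \<subseteq>\<^sub>m t \<or> t \<subseteq>\<^sub>m s}"
  have chain_iff: "pred_on.chain S (\<subseteq>\<^sub>m) C \<longleftrightarrow> C \<subseteq> S \<and> (\<forall>x\<in>C. \<forall>y\<in>C. x \<subseteq>\<^sub>m y \<or> y \<subseteq>\<^sub>m x)"
    for S C :: "('a \<rightharpoonup> 'a) set"
    unfolding pred_on.chain_def by (auto intro: map_le_refl)
  obtain C where C: "pred_on.maxchain A (\<subseteq>\<^sub>m) C"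
    using pred_on.Hausdorff by blast
  then have "pred_on.chain A (\<subseteq>\<^sub>m) C"
    and max: "\<And>D. pred_on.chain A (\<subseteq>\<^sub>m) D \<Longrightarrow> \<not> C \<subset> D"
    unfolding pred_on.maxchain_def by blast+
  then have CA: "C \<subseteq> A" and cmp: "\<And>x y. x \<in> C \<Longrightarrow> y \<in> C \<Longrightarrow> x \<subseteq>\<^sub>m y \<or> y \<subseteq>\<^sub>m x"
    unfolding chain_iff by blast+
  have "pred_on.chain A (\<subseteq>\<^sub>m) (insert t C)"
    using CA cmp assms(2) unfolding chain_iff A_def by (auto simp: map_le_refl)
  then have tC: "t \<in> C"
    using max by blast
  have C_seqs: "C \<subseteq> seqs \<kappa>"
    using CA T unfolding A_def by blast
  \<comment> \<open>A chain of \<open>T\<close> that contains \<open>t\<close> consists of nodes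
    comparable with \<open>t\<close>, so maximality in \<open>A\<close> passes to
    \<open>T\<close>.\<close>
  have "pred_on.maxchain T (\<subseteq>\<^sub>m) C"
    unfolding pred_on.maxchain_def
  proof (intro conjI notI)
    show "pred_on.chain T (\<subseteq>\<^sub>m) C"
      using CA cmp unfolding chain_iff A_def by blast
    assume "\<exists>D. pred_on.chain T (\<subseteq>\<^sub>m) D \<and> C \<subset> D"
    then obtain D where D: "pred_on.chain T (\<subseteq>\<^sub>m) D" "C \<subset> D"
      by blast
    then have "pred_on.chain A (\<subseteq>\<^sub>m) D"
      using tC unfolding chain_iff A_def by blast
    then show False
      using max D(2) by blast
  qed
  then have "branch_cofinality C \<kappa>"
    using assms(1) unfolding regular_tree_def maximal_branch_def by blast
  moreover have "dominates C C"
    unfolding dominates_def using map_le_refl by blast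
  ultimately have large: "\<kappa> \<le>o |C|"
    unfolding branch_cofinality_def by blast
  have "\<exists>s\<in>C. underS \<kappa> \<zeta> \<subseteq> dom s"
  proof (rule ccontr)
    assume "\<not> ?thesis"
    then have none: "\<not> underS \<kappa> \<zeta> \<subseteq> dom s" if "s \<in> C" for s
      using that by blast
    have "seq_length ` C \<subseteq> underS \<kappa> \<zeta>"
    proof
      fix \<eta>
      assume "\<eta> \<in> seq_length ` C"
      then obtain s where s: "s \<in> C" "\<eta> = seq_length s" "s \<in> seqs \<kappa>"
        using C_seqs by blast
      then have "\<eta> \<in> Field \<kappa>" "\<not> underS \<kappa> \<zeta> \<subseteq> underS \<kappa> \<eta>"
        using none[OF s(1)] seq_length(1) dom_seq[OF s(3)] by simp_all
      then show "\<eta> \<in> underS \<kappa> \<zeta>"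
        using wo.TOTALS underS_subset_iff assms(3) unfolding underS_def by blast
    qed
    moreover have "inj_on seq_length C"
    proof (rule inj_onI)
      fix x y
      assume "x \<in> C" "y \<in> C" "seq_length x = seq_length y"
      moreover from this have "dom x = dom y"
        using dom_seq C_seqs by (metis subsetD)
      ultimately show "x = y"
        using cmp map_le_same_dom by (metis order_refl)
    qed
    ultimately have "|C| \<le>o |underS \<kappa> \<zeta>|"
      using card_of_ordLeq by blast
    then have "|C| <o \<kappa>"
      using underS_small[OF assms(3)] by (rule ordLeq_ordLess_trans)
    then show False
      using large not_ordLess_ordLeq by blast
  qed
  then obtain s where s: "s \<in> C" "underS \<kappa> \<zeta> \<subseteq> dom s"
    by blast
  then have "s \<in> T"
    using CA unfolding A_def by blast
  note r = seq_tree_restrict[OF tree this assms(3) s(2)]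
  \<comment> \<open>If \<open>s\<close> extends \<open>t\<close>, then \<open>t\<close> and the cut
    are both initial segments of \<open>s\<close>, and the longer one extends the shorter.\<close>
  have "t \<subseteq>\<^sub>m s |` underS \<kappa> \<zeta> \<or> s |` underS \<kappa> \<zeta> \<subseteq>\<^sub>m t"
  proof (cases "s \<subseteq>\<^sub>m t")
    case True
    then show ?thesis
      using r(2) map_le_trans by blast
  next
    case False
    then have ts: "t \<subseteq>\<^sub>m s"
      using cmp s(1) tC by blast
    have "dom (s |` underS \<kappa> \<zeta>) = underS \<kappa> \<zeta>"
      using s(2) by auto
    moreover have "underS \<kappa> \<zeta> \<subseteq> underS \<kappa> (seq_length t) \<or> underS \<kappa> (seq_length t) \<subseteq> underS \<kappa> \<zeta>"
      using wo.TOTALS underS_subset_iff assms(2,3) seq_length(1) T by blast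
    ultimately show ?thesis
      using map_le_common_bound[OF ts r(2)] map_le_common_bound[OF r(2) ts] dom_seq assms(2) T by auto
  qed
  then show ?thesis
    using r(1) by blast
qed

section \<open>Counting tuples of nodes\<close>

lemma card_UNION_small_le:
  assumes "\<And>\<zeta>. \<zeta> \<in> Field \<kappa> \<Longrightarrow> |A \<zeta>| <o \<kappa>"
  shows "|\<Union>\<zeta>\<in>Field \<kappa>. A \<zeta>| \<le>o \<kappa>"
proof (rule card_of_UNION_ordLeq_infinite_Field[OF infinite_Field Card_order])
  show "|Field \<kappa>| \<le>o \<kappa>"
    using card_Field ordIso_imp_ordLeq by blast
  show "\<forall>\<zeta>\<in>Field \<kappa>. |A \<zeta>| \<le>o \<kappa>"
    using assms ordLess_imp_ordLeq by blast
qed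

text \<open>By regularity, the lengths occurring in one tuple are bounded below \<kappa>. Hence the
  product is covered by \<kappa> many products of truncated trees \<open>B i \<zeta>\<close>, each
  of size less than \<kappa>.\<close>

lemma card_PiE_kappa_trees_le:
  assumes "|I| <o \<kappa>" and "\<And>i. i \<in> I \<Longrightarrow> kappa_tree \<kappa> (T i)"
  shows "|\<Pi>\<^sub>E i\<in>I. T i| \<le>o \<kappa>"
proof -
  define B where "B i \<zeta> = (\<Union>\<eta>\<in>underS \<kappa> \<zeta>. level \<kappa> (T i) \<eta>)" for i \<zeta>
  have "|\<Pi>\<^sub>E i\<in>I. B i \<zeta>| <o \<kappa>" if "\<zeta> \<in> Field \<kappa>" for \<zeta>
  proof (rule PiE_small[OF assms(1)])
    fix i
    assume i: "i \<in> I"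
    show "|B i \<zeta>| <o \<kappa>"
      unfolding B_def
    proof (rule stable_UNION[OF stable underS_small[OF that]])
      fix \<eta>
      assume "\<eta> \<in> underS \<kappa> \<zeta>"
      then have "\<eta> \<in> Field \<kappa>"
        unfolding underS_def Field_def by auto
      then show "|level \<kappa> (T i) \<eta>| <o \<kappa>"
        using assms(2)[OF i] unfolding kappa_tree_def by blast
    qed
  qed
  then have "|\<Union>\<zeta>\<in>Field \<kappa>. \<Pi>\<^sub>E i\<in>I. B i \<zeta>| \<le>o \<kappa>"
    by (rule card_UNION_small_le)
  moreover have "(\<Pi>\<^sub>E i\<in>I. T i) \<subseteq> (\<Union>\<zeta>\<in>Field \<kappa>. \<Pi>\<^sub>E i\<in>I. B i \<zeta>)"
  proof
    fix x
    assume x: "x \<in> (\<Pi>\<^sub>E i\<in>I. T i)"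
    then have xs: "x i \<in> seqs \<kappa>" if "i \<in> I" for i
      using that assms(2) unfolding kappa_tree_def seq_tree_def by blast
    have "|(\<lambda>i. seq_length (x i)) ` I| <o \<kappa>"
      using assms(1) by (rule image_small)
    moreover have "(\<lambda>i. seq_length (x i)) ` I \<subseteq> Field \<kappa>"
      using xs seq_length(1) by blast
    ultimately obtain \<zeta> where "\<zeta> \<in> Field \<kappa>"
      and "\<And>\<eta>. \<eta> \<in> (\<lambda>i. seq_length (x i)) ` I \<Longrightarrow> \<eta> \<in> underS \<kappa> \<zeta>"
      using bounded by metis
    moreover from this(2) have "x i \<in> B i \<zeta>" if "i \<in> I" for i
      using that x xs seq_length(2) unfolding B_def level_def by blast
    ultimately show "x \<in> (\<Union>\<zeta>\<in>Field \<kappa>. \<Pi>\<^sub>E i\<in>I. B i \<zeta>)"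
      using x by (auto simp: PiE_iff)
  qed
  ultimately show ?thesis
    using card_of_mono1 ordLeq_transitive by metis
qed

section \<open>Limits of colourings from the tree property\<close>

lemma tree_property_limit:
  assumes "weakly_compact \<kappa>" and "S \<subseteq> Field \<kappa>" and "|S| <o \<kappa>"
    and F: "\<And>\<zeta> \<alpha>. \<zeta> \<in> Field \<kappa> \<Longrightarrow> F \<zeta> \<alpha> \<in> S"
  shows "\<exists>g. \<forall>\<eta>\<in>Field \<kappa>. \<exists>\<zeta>. (\<eta>, \<zeta>) \<in> \<kappa> \<and> (\<forall>\<alpha>\<in>underS \<kappa> \<eta>. F \<zeta> \<alpha> = g \<alpha>)"
proof -
  \<comment> \<open>Row \<zeta> of \<open>F\<close> is a \<kappa>-sequence in \<open>S\<close>, and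
    \<open>N \<zeta> \<eta>\<close> is its initial segment of length \<eta>. Nodes of length \<eta>
    are taken only from rows \<zeta> \<ge> \<eta>; this is what makes a cofinal branch agree with
    rows of arbitrarily large index.\<close>
  define N where "N \<zeta> \<eta> = (\<lambda>\<alpha>. Some (F \<zeta> \<alpha>)) |` underS \<kappa> \<eta>" for \<zeta> \<eta>
  define T where "T = {N \<zeta> \<eta> |\<zeta> \<eta>. (\<eta>, \<zeta>) \<in> \<kappa>}"
  have FieldI: "\<eta> \<in> Field \<kappa>" "\<zeta> \<in> Field \<kappa>" if "(\<eta>, \<zeta>) \<in> \<kappa>" for \<eta> \<zeta>
    using that unfolding Field_def by auto
  have dom_N: "dom (N \<zeta> \<eta>) = underS \<kappa> \<eta>" for \<zeta> \<eta>
    unfolding N_def by auto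
  have N_length: "N \<zeta> \<eta> \<in> seqs_of_length \<kappa> \<eta>" if "\<zeta> \<in> Field \<kappa>" for \<zeta> \<eta>
    using F[OF that] assms(2) dom_N unfolding seqs_of_length_def
    by (auto simp: N_def ran_def restrict_map_def split: if_splits)
  have N_level: "N \<eta> \<eta> \<in> level \<kappa> T \<eta>" if "\<eta> \<in> Field \<kappa>" for \<eta>
    using N_length[OF that] wo.REFL that unfolding level_def T_def refl_on_def by blast
  have T_seqs: "T \<subseteq> seqs \<kappa>"
  proof
    fix s
    assume "s \<in> T"
    then obtain \<zeta> \<eta> where "s = N \<zeta> \<eta>" "(\<eta>, \<zeta>) \<in> \<kappa>"
      unfolding T_def by blast
    then show "s \<in> seqs \<kappa>"
      using N_length[of \<zeta> \<eta>] FieldI[of \<eta> \<zeta>] unfolding seqs_def by blast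
  qed
  have level_T: "\<exists>\<zeta>. (\<eta>, \<zeta>) \<in> \<kappa> \<and> s = N \<zeta> \<eta>" if sT: "s \<in> level \<kappa> T \<eta>" and \<eta>: "\<eta> \<in> Field \<kappa>" for s \<eta>
  proof -
    obtain \<zeta> \<eta>' where s: "s = N \<zeta> \<eta>'" "(\<eta>', \<zeta>) \<in> \<kappa>"
      using sT unfolding level_def T_def by blast
    then have "underS \<kappa> \<eta>' = underS \<kappa> \<eta>"
      using sT dom_N unfolding level_def seqs_of_length_def by auto
    then have "\<eta>' = \<eta>"
      using underS_inject FieldI(1)[OF s(2)] \<eta> by simp
    then show ?thesis
      using s by blast
  qed
  have tree: "seq_tree \<kappa> T"
    unfolding seq_tree_def
  proof (intro conjI ballI impI)
    fix t s
    assume "t \<in> T" and s: "s \<in> seqs \<kappa>" "s \<subseteq>\<^sub>m t"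
    then obtain \<zeta> \<eta> where t: "t = N \<zeta> \<eta>" "(\<eta>, \<zeta>) \<in> \<kappa>"
      unfolding T_def by blast
    \<comment> \<open>An initial segment of a node comes from the same row \<zeta>, and its length
      is still at most \<zeta>.\<close>
    have ds: "dom s = underS \<kappa> (seq_length s)"
      using s(1) by (rule dom_seq)
    then have sub: "underS \<kappa> (seq_length s) \<subseteq> underS \<kappa> \<eta>"
      using map_le_implies_dom_le[OF s(2)] t(1) dom_N by simp
    then have "(seq_length s, \<eta>) \<in> \<kappa>"
      using underS_subset_iff seq_length(1)[OF s(1)] FieldI(1)[OF t(2)] by blast
    then have "(seq_length s, \<zeta>) \<in> \<kappa>"
      using t(2) wo.TRANS unfolding trans_def by blast
    moreover have "s = N \<zeta> (seq_length s)"
    proof (rule map_le_same_dom)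
      show "s \<subseteq>\<^sub>m N \<zeta> (seq_length s)"
        using s(2) ds sub unfolding map_le_def t(1) N_def by (auto simp: restrict_map_def)
      show "dom (N \<zeta> (seq_length s)) \<subseteq> dom s"
        using dom_N ds by simp
    qed
    ultimately show "s \<in> T"
      unfolding T_def by blast
  qed (use T_seqs in blast)
  have level_small: "|level \<kappa> T \<eta>| <o \<kappa>" if \<eta>: "\<eta> \<in> Field \<kappa>" for \<eta>
  proof -
    let ?R = "(\<lambda>x. (\<lambda>\<alpha>. Some (x \<alpha>)) |` underS \<kappa> \<eta>) ` (underS \<kappa> \<eta> \<rightarrow>\<^sub>E S)"
    have "level \<kappa> T \<eta> \<subseteq> ?R"
    proof
      fix s
      assume "s \<in> level \<kappa> T \<eta>"
      then obtain \<zeta> where \<zeta>: "(\<eta>, \<zeta>) \<in> \<kappa>" "s = N \<zeta> \<eta>"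
        using level_T[OF _ \<eta>] by blast
      then have "s = (\<lambda>\<alpha>. Some (restrict (F \<zeta>) (underS \<kappa> \<eta>) \<alpha>)) |` underS \<kappa> \<eta>"
        unfolding N_def by (auto simp: restrict_map_def)
      moreover have "restrict (F \<zeta>) (underS \<kappa> \<eta>) \<in> underS \<kappa> \<eta> \<rightarrow>\<^sub>E S"
        using F FieldI(2)[OF \<zeta>(1)] by auto
      ultimately show "s \<in> ?R"
        by blast
    qed
    moreover have "|?R| <o \<kappa>"
      using image_small PiE_small[OF underS_small[OF \<eta>] assms(3)] by blast
    ultimately show ?thesis
      by (rule subset_small)
  qed
  have "|T| \<le>o \<kappa>"
  proof -
    have "T \<subseteq> (\<Union>\<eta>\<in>Field \<kappa>. level \<kappa> T \<eta>)"
      using T_seqs unfolding seqs_def level_def by blast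
    from card_of_mono1[OF this] card_UNION_small_le[OF level_small] show ?thesis
      by (rule ordLeq_transitive)
  qed
  moreover have "\<kappa> \<le>o |T|"
  proof -
    \<comment> \<open>The diagonal nodes have pairwise different lengths, so \<open>T\<close> has at
      least \<kappa> nodes.\<close>
    have "inj_on (\<lambda>\<eta>. N \<eta> \<eta>) (Field \<kappa>)"
      by (rule inj_onI) (metis dom_N underS_inject)
    moreover have "(\<lambda>\<eta>. N \<eta> \<eta>) ` Field \<kappa> \<subseteq> T"
      using N_level unfolding level_def by blast
    ultimately have "|Field \<kappa>| \<le>o |T|"
      using card_of_ordLeq by blast
    then show ?thesis
      by (rule ordIso_ordLeq_trans[OF ordIso_symmetric[OF card_Field]])
  qed
  ultimately have "kappa_tree \<kappa> T"
    using tree level_small ordIso_iff_ordLeq unfolding kappa_tree_def by metis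
  then obtain B where B: "cofinal_branch \<kappa> T B"
    using assms(1) unfolding weakly_compact_def by blast
  then have "\<forall>\<eta>\<in>Field \<kappa>. \<exists>s. s \<in> B \<inter> level \<kappa> T \<eta>"
    unfolding cofinal_branch_def by blast
  then obtain n where n: "\<And>\<eta>. \<eta> \<in> Field \<kappa> \<Longrightarrow> n \<eta> \<in> B" "\<And>\<eta>. \<eta> \<in> Field \<kappa> \<Longrightarrow> n \<eta> \<in> level \<kappa> T \<eta>"
    by (metis IntD1 IntD2)
  have chain: "s \<subseteq>\<^sub>m t \<or> t \<subseteq>\<^sub>m s" if "s \<in> B" "t \<in> B" for s t
    using B that map_le_refl
    unfolding cofinal_branch_def maximal_branch_def pred_on.maxchain_def pred_on.chain_def by blast
  \<comment> \<open>Length \<alpha> + 1 is the least that has \<alpha> in the domain. Every longer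
    node of the branch has the same value at \<alpha>, because the branch is a chain.\<close>
  define g where "g \<alpha> = the (n (ord_suc \<kappa> \<alpha>) \<alpha>)" for \<alpha>
  have "\<exists>\<zeta>. (\<eta>, \<zeta>) \<in> \<kappa> \<and> (\<forall>\<alpha>\<in>underS \<kappa> \<eta>. F \<zeta> \<alpha> = g \<alpha>)" if \<eta>: "\<eta> \<in> Field \<kappa>" for \<eta>
  proof -
    obtain \<zeta> where \<zeta>: "(\<eta>, \<zeta>) \<in> \<kappa>" "n \<eta> = N \<zeta> \<eta>"
      using level_T n(2) \<eta> by blast
    have "F \<zeta> \<alpha> = g \<alpha>" if \<alpha>: "\<alpha> \<in> underS \<kappa> \<eta>" for \<alpha>
    proof -
      have "\<alpha> \<in> Field \<kappa>"
        using \<alpha> unfolding underS_def Field_def by auto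
      note suc = ord_suc_in_Field[OF this] underS_ord_suc[OF this]
      have "\<alpha> \<in> dom (n (ord_suc \<kappa> \<alpha>))"
        using n(2)[OF suc(1)] suc(2) unfolding level_def seqs_of_length_def by blast
      moreover have "\<alpha> \<in> dom (n \<eta>)"
        using \<zeta>(2) dom_N \<alpha> by simp
      ultimately have "n (ord_suc \<kappa> \<alpha>) \<alpha> = n \<eta> \<alpha>"
        using chain[OF n(1)[OF suc(1)] n(1)[OF \<eta>]] unfolding map_le_def by metis
      then show ?thesis
        unfolding g_def \<zeta>(2) N_def using \<alpha> by simp
    qed
    then show ?thesis
      using \<zeta>(1) by blast
  qed
  then show ?thesis
    by blast
qed

text \<open>
  \<open>g p\<close> behaves like the limit of \<open>f p \<zeta>\<close> for \<open>\<zeta> \<rightarrow> \<kappa>\<close> along a \<open>\<kappa>\<close>-complete ultrafilter.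
\<close>

lemma simultaneous_limit:
  fixes P :: "'p set" and S :: "'s set"
  assumes "weakly_compact \<kappa>" and "|P| \<le>o \<kappa>" and "|S| <o \<kappa>"
    and f: "\<And>p \<zeta>. p \<in> P \<Longrightarrow> \<zeta> \<in> Field \<kappa> \<Longrightarrow> f p \<zeta> \<in> S"
  shows "\<exists>g\<in>P \<rightarrow> S. \<forall>A\<subseteq>P. |A| <o \<kappa> \<longrightarrow>
           (\<forall>\<eta>\<in>Field \<kappa>. \<exists>\<zeta>. (\<eta>, \<zeta>) \<in> \<kappa> \<and> (\<forall>p\<in>A. f p \<zeta> = g p))"
proof (cases "P = {}")
  \<comment> \<open>Here \<open>S\<close> may be empty too and offer no default value. The claim
    only asks for some \<zeta> \<ge> \<eta>, and \<eta> itself serves.\<close>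
  case True
  then show ?thesis
    using wo.REFL unfolding refl_on_def by blast
next
  case False
  obtain \<zeta>0 where "\<zeta>0 \<in> Field \<kappa>"
    using infinite_Field by fastforce
  then obtain s0 where s0: "s0 \<in> S"
    using f False by blast
  \<comment> \<open>Points of \<open>P\<close> are indexed by ordinals below \<kappa> through
    \<open>h\<close>, and values in \<open>S\<close> are coded by such ordinals through
    \<open>e\<close>. This turns \<open>f\<close> into rows to which
    \<open>tree_property_limit\<close> applies.\<close>
  have "|P| \<le>o |Field \<kappa>|"
    using assms(2) card_Field ordIso_symmetric ordLeq_ordIso_trans by metis
  then obtain h where h: "inj_on h P" "h ` P \<subseteq> Field \<kappa>"
    using card_of_ordLeq by metis
  have "|S| \<le>o |Field \<kappa>|"
    using assms(3) card_Field ordIso_symmetric ordLeq_ordIso_trans ordLess_imp_ordLeq by metis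
  then obtain e where e: "inj_on e S" "e ` S \<subseteq> Field \<kappa>"
    using card_of_ordLeq by metis
  \<comment> \<open>Ordinals that index no point receive the default \<open>s0\<close>, so that
    every row is total with values among the codes of \<open>S\<close>.\<close>
  define F where "F \<zeta> \<alpha> = e (if \<alpha> \<in> h ` P then f (inv_into P h \<alpha>) \<zeta> else s0)" for \<zeta> \<alpha>
  have "F \<zeta> \<alpha> \<in> e ` S" if "\<zeta> \<in> Field \<kappa>" for \<zeta> \<alpha>
    unfolding F_def using f[OF inv_into_into[of \<alpha> h] that] s0 by simp
  then obtain G where
    G: "\<And>\<eta>. \<eta> \<in> Field \<kappa> \<Longrightarrow> \<exists>\<zeta>. (\<eta>, \<zeta>) \<in> \<kappa> \<and> (\<forall>\<alpha>\<in>underS \<kappa> \<eta>. F \<zeta> \<alpha> = G \<alpha>)"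
    using tree_property_limit[OF assms(1) e(2) image_small[OF assms(3)], of F] by blast
  define g where "g p = inv_into S e (G (h p))" for p
  have g: "\<exists>\<zeta>. (\<eta>, \<zeta>) \<in> \<kappa> \<and> (\<forall>p\<in>A. f p \<zeta> = g p)"
    if A: "A \<subseteq> P" "|A| <o \<kappa>" and \<eta>: "\<eta> \<in> Field \<kappa>" for A \<eta>
  proof -
    \<comment> \<open>With \<eta> added to the indices of \<open>A\<close>, the bound
      \<open>a\<close> serves twice: some row \<zeta> \<ge> \<open>a\<close> agrees with the limit
      on all of \<open>A\<close>, and this \<zeta> is also above \<eta>.\<close>
    have "|h ` A \<union> {\<eta>}| <o \<kappa>"
      by (intro Un_small image_small A(2) finite_small) simp
    moreover have "h ` A \<union> {\<eta>} \<subseteq> Field \<kappa>"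
      using A(1) h(2) \<eta> by blast
    ultimately obtain a where a: "a \<in> Field \<kappa>" "\<And>b. b \<in> h ` A \<union> {\<eta>} \<Longrightarrow> b \<in> underS \<kappa> a"
      using bounded by metis
    obtain \<zeta> where \<zeta>: "(a, \<zeta>) \<in> \<kappa>" "\<And>\<alpha>. \<alpha> \<in> underS \<kappa> a \<Longrightarrow> F \<zeta> \<alpha> = G \<alpha>"
      using G[OF a(1)] by blast
    have "(\<eta>, a) \<in> \<kappa>"
      using a(2)[of \<eta>] unfolding underS_def by blast
    then have "(\<eta>, \<zeta>) \<in> \<kappa>"
      using \<zeta>(1) wo.TRANS unfolding trans_def by blast
    moreover have "f p \<zeta> = g p" if "p \<in> A" for p
    proof -
      have "p \<in> P" "h p \<in> underS \<kappa> a"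
        using that A(1) a(2) by auto
      then have "G (h p) = e (f p \<zeta>)"
        using \<zeta>(2)[of "h p"] inv_into_f_f[OF h(1)] unfolding F_def by simp
      moreover have "f p \<zeta> \<in> S"
        using f[OF \<open>p \<in> P\<close>] \<zeta>(1) unfolding Field_def by blast
      ultimately show ?thesis
        unfolding g_def using e(1) by simp
    qed
    ultimately show ?thesis
      by blast
  qed
  \<comment> \<open>For a singleton, the agreement shows that \<open>g p\<close> is a value of
    \<open>f p\<close> at some stage.\<close>
  have "g p \<in> S" if p: "p \<in> P" for p
  proof -
    obtain \<zeta> where "(\<zeta>0, \<zeta>) \<in> \<kappa>" "f p \<zeta> = g p"
      using g[of "{p}" \<zeta>0] p finite_small[of "{p}"] \<open>\<zeta>0 \<in> Field \<kappa>\<close> by auto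
    then show ?thesis
      using f[OF p, of \<zeta>] unfolding Field_def by auto
  qed
  then show ?thesis
    using g by blast
qed

section \<open>The two implications\<close>

lemma SDHL_imp_SDHL':
  assumes "SDHL \<delta> \<sigma> \<kappa>"
  shows "SDHL' \<delta> \<sigma> \<kappa>"
  unfolding SDHL'_def
proof (intro allI impI, elim conjE)
  fix T c
  assume T: "\<forall>i\<in>Field \<delta>. regular_tree \<kappa> (T i)" and c: "c \<in> (\<Pi>\<^sub>E i\<in>Field \<delta>. T i) \<rightarrow> Field \<sigma>"
  have sub: "level_product \<kappa> \<delta> T \<subseteq> (\<Pi>\<^sub>E i\<in>Field \<delta>. T i)"
    unfolding level_product_def level_def by (auto simp: PiE_iff)
  then have "c \<in> level_product \<kappa> \<delta> T \<rightarrow> Field \<sigma>"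
    using c by blast
  then obtain \<zeta> \<zeta>' t X where \<zeta>: "\<zeta> \<in> Field \<kappa>" "\<zeta>' \<in> Field \<kappa>"
    and t: "\<forall>i\<in>Field \<delta>. t i \<in> level \<kappa> (T i) \<zeta>"
    and X: "\<forall>i\<in>Field \<delta>. X i \<subseteq> level \<kappa> (T i) \<zeta>'"
    and dom: "\<forall>i\<in>Field \<delta>. dominates (X i) (level \<kappa> (T i) (ord_suc \<kappa> \<zeta>) \<inter> Cone \<kappa> (t i))"
    and card: "card (c ` level_product \<kappa> \<delta> X) = 1"
    using assms T unfolding SDHL_def by metis
  have XT: "\<forall>i\<in>Field \<delta>. X i \<subseteq> T i"
    using X unfolding level_def by blast
  have "\<forall>i\<in>Field \<delta>. dominates (X i) (successors (T i) (t i))"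
    using dom successors_eq[OF _ \<zeta>(1)] t T unfolding regular_tree_def kappa_tree_def by metis
  then have "somewhere_dense_matrix \<kappa> \<delta> T X"
    unfolding somewhere_dense_matrix_def using XT t \<zeta>(1) by blast
  moreover have "\<exists>k\<in>Field \<sigma>. \<forall>x\<in>(\<Pi>\<^sub>E i\<in>Field \<delta>. X i). c x = k"
  proof -
    \<comment> \<open>All \<open>X i\<close> lie on the single level \<zeta>', so every tuple of
      their full product is a level tuple.\<close>
    have "(\<Pi>\<^sub>E i\<in>Field \<delta>. X i) \<subseteq> level_product \<kappa> \<delta> X"
      unfolding level_product_def level_def using X \<zeta>(2) by (fastforce simp: PiE_iff level_def)
    moreover obtain k where k: "c ` level_product \<kappa> \<delta> X = {k}"
      using card card_1_singletonE by blast
    \<comment> \<open>Cardinality 1 includes that \<open>k\<close> is attained, and it is attained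
      on a tuple of nodes of the trees.\<close>
    moreover have "k \<in> Field \<sigma>"
    proof -
      obtain x where "x \<in> level_product \<kappa> \<delta> X" "c x = k"
        using k by blast
      moreover from this have "x \<in> (\<Pi>\<^sub>E i\<in>Field \<delta>. T i)"
        using XT unfolding level_product_def level_def by (fastforce simp: PiE_iff)
      ultimately show ?thesis
        using c by blast
    qed
    ultimately show ?thesis
      by blast
  qed
  ultimately show "\<exists>X. somewhere_dense_matrix \<kappa> \<delta> T X \<and>
      (\<exists>k\<in>Field \<sigma>. \<forall>x\<in>(\<Pi>\<^sub>E i\<in>Field \<delta>. X i). c x = k)"
    by blast
qed

lemma SDHL'_imp_SDHL:
  assumes "weakly_compact \<kappa>" and \<delta>: "|Field \<delta>| <o \<kappa>" and \<sigma>: "|Field \<sigma>| <o \<kappa>"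
    and "SDHL' \<delta> \<sigma> \<kappa>"
  shows "SDHL \<delta> \<sigma> \<kappa>"
  unfolding SDHL_def
proof (intro allI impI, elim conjE)
  fix T c
  assume T: "\<forall>i\<in>Field \<delta>. regular_tree \<kappa> (T i)" and c: "c \<in> level_product \<kappa> \<delta> T \<rightarrow> Field \<sigma>"
  let ?P = "\<Pi>\<^sub>E i\<in>Field \<delta>. T i"
  have kappa_tree: "kappa_tree \<kappa> (T i)" and tree: "seq_tree \<kappa> (T i)"
    and T_seqs: "T i \<subseteq> seqs \<kappa>" if "i \<in> Field \<delta>" for i
    using T that unfolding regular_tree_def kappa_tree_def seq_tree_def by blast+
  have "\<exists>s. s \<in> level \<kappa> (T i) \<zeta> \<and> (x \<subseteq>\<^sub>m s \<or> s \<subseteq>\<^sub>m x)"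
    if "i \<in> Field \<delta>" "x \<in> T i" "\<zeta> \<in> Field \<kappa>" for i x \<zeta>
    using regular_tree_comparable_node[of "T i" x \<zeta>] T that by blast
  \<comment> \<open>The node \<open>b i x \<zeta>\<close> extends \<open>x\<close> when \<zeta> is
    at least the length of \<open>x\<close>, and is an initial segment of \<open>x\<close>
    otherwise. The second case lets a tuple be moved to every level.\<close>
  then obtain b where
    b: "\<And>i x \<zeta>. i \<in> Field \<delta> \<Longrightarrow> x \<in> T i \<Longrightarrow> \<zeta> \<in> Field \<kappa> \<Longrightarrow>
          b i x \<zeta> \<in> level \<kappa> (T i) \<zeta> \<and> (x \<subseteq>\<^sub>m b i x \<zeta> \<or> b i x \<zeta> \<subseteq>\<^sub>m x)"
    by metis
  have b_above: "x \<subseteq>\<^sub>m b i x \<zeta>"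
    if "i \<in> Field \<delta>" "x \<in> T i" "\<zeta> \<in> Field \<kappa>" "(seq_length x, \<zeta>) \<in> \<kappa>" for i x \<zeta>
  proof -
    have x: "x \<in> seqs \<kappa>"
      using T_seqs that(1,2) by blast
    have "dom (b i x \<zeta>) = underS \<kappa> \<zeta>"
      using b[OF that(1-3)] unfolding level_def seqs_of_length_def by blast
    then have "dom x \<subseteq> dom (b i x \<zeta>)"
      using dom_seq[OF x] underS_subset_iff[OF seq_length(1)[OF x] that(3)] that(4) by simp
    then show ?thesis
      using b[OF that(1-3)] map_le_same_dom map_le_refl by metis
  qed
  define lift where "lift x \<zeta> = (\<lambda>i\<in>Field \<delta>. b i (x i) \<zeta>)" for x \<zeta>
  have "lift x \<zeta> \<in> level_product \<kappa> \<delta> T" if "x \<in> ?P" "\<zeta> \<in> Field \<kappa>" for x \<zeta>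
    unfolding level_product_def lift_def using b[OF _ _ that(2)] that by (fastforce simp: PiE_iff)
  then have c_lift: "c (lift x \<zeta>) \<in> Field \<sigma>" if "x \<in> ?P" "\<zeta> \<in> Field \<kappa>" for x \<zeta>
    using c that by blast
  \<comment> \<open>The points are the tuples of the full product and the stages are the levels.
    Thus \<open>g\<close> colours tuples of mixed lengths, and \<open>SDHL'\<close> can be applied
    to it.\<close>
  obtain g where g: "g \<in> ?P \<rightarrow> Field \<sigma>"
    and lim: "\<forall>A\<subseteq>?P. |A| <o \<kappa> \<longrightarrow>
           (\<forall>\<eta>\<in>Field \<kappa>. \<exists>\<zeta>. (\<eta>, \<zeta>) \<in> \<kappa> \<and> (\<forall>x\<in>A. c (lift x \<zeta>) = g x))"
    by (rule bexE[OF simultaneous_limit[where f = "\<lambda>x \<zeta>. c (lift x \<zeta>)",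
          OF assms(1) card_PiE_kappa_trees_le[OF \<delta> kappa_tree] \<sigma> c_lift]])
  obtain X k where X: "somewhere_dense_matrix \<kappa> \<delta> T X" and k: "\<forall>x\<in>(\<Pi>\<^sub>E i\<in>Field \<delta>. X i). g x = k"
    using assms(4) T g unfolding SDHL'_def by metis
  obtain t \<zeta> where \<zeta>: "\<zeta> \<in> Field \<kappa>" and t: "\<And>i. i \<in> Field \<delta> \<Longrightarrow> t i \<in> level \<kappa> (T i) \<zeta>"
    and dom: "\<And>i. i \<in> Field \<delta> \<Longrightarrow> dominates (X i) (successors (T i) (t i))"
    and XT: "\<And>i. i \<in> Field \<delta> \<Longrightarrow> X i \<subseteq> T i"
    using X unfolding somewhere_dense_matrix_def by metis
  define Y where "Y i = level \<kappa> (T i) (ord_suc \<kappa> \<zeta>) \<inter> Cone \<kappa> (t i)" for i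
  note suc = ord_suc_in_Field[OF \<zeta>] underS_ord_suc[OF \<zeta>]
  have tT: "t i \<in> T i" and t_length: "seq_length (t i) = \<zeta>" if "i \<in> Field \<delta>" for i
    using t[OF that] seq_length_eq[OF \<zeta>] unfolding level_def by auto
  \<comment> \<open>\<open>SDHL\<close> asks for exactly one colour, so the final product must not
    be empty.\<close>
  have Y_ne: "Y i \<noteq> {}" if i: "i \<in> Field \<delta>" for i
  proof -
    have "(seq_length (t i), ord_suc \<kappa> \<zeta>) \<in> \<kappa>"
      using suc(2) t_length[OF i] unfolding underS_def by blast
    then have "t i \<subseteq>\<^sub>m b i (t i) (ord_suc \<kappa> \<zeta>)"
      using b_above i tT suc(1) by blast
    moreover have "b i (t i) (ord_suc \<kappa> \<zeta>) \<in> level \<kappa> (T i) (ord_suc \<kappa> \<zeta>)"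
      using b i tT suc(1) by blast
    ultimately have "b i (t i) (ord_suc \<kappa> \<zeta>) \<in> Y i"
      using T_seqs[OF i] unfolding Y_def Cone_def level_def by blast
    then show ?thesis
      by blast
  qed
  have "\<exists>x. x \<in> X i \<and> y \<subseteq>\<^sub>m x" if "i \<in> Field \<delta>" "y \<in> Y i" for i y
    using dom successors_eq[OF tree \<zeta> t] that unfolding dominates_def Y_def by blast
  then obtain d where d: "\<And>i y. i \<in> Field \<delta> \<Longrightarrow> y \<in> Y i \<Longrightarrow> d i y \<in> X i \<and> y \<subseteq>\<^sub>m d i y"
    by metis
  \<comment> \<open>One node of \<open>X i\<close> is kept above each successor of
    \<open>t i\<close>. The successors are still dominated, and since they lie on one level, fewer
    than \<kappa> nodes remain, as the limit property of \<open>g\<close> requires.\<close>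
  define Z where "Z i = d i ` Y i" for i
  have ZX: "Z i \<subseteq> X i" and ZT: "Z i \<subseteq> T i" if "i \<in> Field \<delta>" for i
    using d XT that unfolding Z_def by blast+
  have Z_small: "|Z i| <o \<kappa>" if "i \<in> Field \<delta>" for i
  proof -
    have "|level \<kappa> (T i) (ord_suc \<kappa> \<zeta>)| <o \<kappa>"
      using kappa_tree[OF that] suc(1) unfolding kappa_tree_def by blast
    then have "|Y i| <o \<kappa>"
      unfolding Y_def by (rule subset_small[rotated]) blast
    then show ?thesis
      unfolding Z_def by (rule image_small)
  qed
  \<comment> \<open>Lifting to a level beyond all these lengths extends every node of the
    \<open>Z i\<close>. The element \<zeta> is included to secure \<zeta> < \<zeta>'.\<close>
  define L where "L = (\<Union>i\<in>Field \<delta>. seq_length ` Z i) \<union> {\<zeta>}"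
  have "|L| <o \<kappa>"
    unfolding L_def
    by (intro Un_small stable_UNION[OF stable \<delta>] image_small Z_small finite_small) auto
  moreover have "L \<subseteq> Field \<kappa>"
    unfolding L_def using \<zeta> seq_length(1) ZT T_seqs by blast
  ultimately obtain \<eta> where \<eta>: "\<eta> \<in> Field \<kappa>" "\<And>\<alpha>. \<alpha> \<in> L \<Longrightarrow> \<alpha> \<in> underS \<kappa> \<eta>"
    using bounded by metis
  let ?A = "\<Pi>\<^sub>E i\<in>Field \<delta>. Z i"
  have "?A \<subseteq> ?P"
    using ZT by (rule PiE_mono)
  moreover have "|?A| <o \<kappa>"
    by (rule PiE_small[OF \<delta> Z_small])
  ultimately have "\<exists>\<zeta>'. (\<eta>, \<zeta>') \<in> \<kappa> \<and> (\<forall>x\<in>?A. c (lift x \<zeta>') = g x)"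
    using lim[THEN spec, of ?A] \<eta>(1) by simp
  then obtain \<zeta>' where \<zeta>': "(\<eta>, \<zeta>') \<in> \<kappa>" and lim': "\<And>x. x \<in> ?A \<Longrightarrow> c (lift x \<zeta>') = g x"
    by blast
  have \<zeta>'_Field: "\<zeta>' \<in> Field \<kappa>"
    using \<zeta>' unfolding Field_def by blast
  have below: "\<alpha> \<in> underS \<kappa> \<zeta>'" if "\<alpha> \<in> L" for \<alpha>
    using \<eta>(2)[OF that] underS_subset_iff[OF \<eta>(1) \<zeta>'_Field] \<zeta>' by blast
  have const: "c (lift x \<zeta>') = k" if "x \<in> ?A" for x
  proof -
    have "?A \<subseteq> (\<Pi>\<^sub>E i\<in>Field \<delta>. X i)"
      using ZX by (rule PiE_mono)
    then show ?thesis
      using lim'[OF that] bspec[OF k subsetD[OF _ that]] by simp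
  qed
  \<comment> \<open>The lifts lie on one level and extend the nodes of \<open>Z i\<close>, so
    domination survives; their tuples are lifts of tuples from the \<open>Z i\<close>, on which
    \<open>c\<close> takes the value \<open>k\<close>.\<close>
  define W where "W i = (\<lambda>x. b i x \<zeta>') ` Z i" for i
  have W_level: "W i \<subseteq> level \<kappa> (T i) \<zeta>'" if "i \<in> Field \<delta>" for i
    using b[OF that _ \<zeta>'_Field] ZT[OF that] unfolding W_def by blast
  have W_dom: "dominates (W i) (Y i)" if i: "i \<in> Field \<delta>" for i
    unfolding dominates_def
  proof
    fix y
    assume y: "y \<in> Y i"
    then have dZ: "d i y \<in> Z i"
      unfolding Z_def by blast
    then have "seq_length (d i y) \<in> L"
      using i unfolding L_def by blast
    then have "(seq_length (d i y), \<zeta>') \<in> \<kappa>"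
      using below unfolding underS_def by blast
    then have "d i y \<subseteq>\<^sub>m b i (d i y) \<zeta>'"
      using b_above[OF i _ \<zeta>'_Field] ZT[OF i] dZ by blast
    then have "y \<subseteq>\<^sub>m b i (d i y) \<zeta>'"
      using d[OF i y] map_le_trans by blast
    then show "\<exists>x\<in>W i. y \<subseteq>\<^sub>m x"
      unfolding W_def using dZ by blast
  qed
  have "c ` level_product \<kappa> \<delta> W = {k}"
  proof (intro equalityI subsetI)
    fix u
    assume "u \<in> c ` level_product \<kappa> \<delta> W"
    then obtain w where w: "u = c w" "w \<in> (\<Pi>\<^sub>E i\<in>Field \<delta>. W i)"
      unfolding level_product_def level_def by (auto simp: PiE_iff)
    then have "\<exists>x. x \<in> Z i \<and> w i = b i x \<zeta>'" if "i \<in> Field \<delta>" for i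
      using that unfolding W_def by (auto simp: PiE_iff)
    \<comment> \<open>A preimage is chosen in each coordinate. Restricting the choice to
      \<open>Field \<delta>\<close> makes it a member of the extensional product.\<close>
    then obtain x where x: "\<And>i. i \<in> Field \<delta> \<Longrightarrow> x i \<in> Z i \<and> w i = b i (x i) \<zeta>'"
      by metis
    have "w = lift (restrict x (Field \<delta>)) \<zeta>'"
      using w(2) x unfolding lift_def by (auto simp: PiE_iff extensional_def restrict_def)
    moreover have "restrict x (Field \<delta>) \<in> ?A"
      using x by auto
    ultimately show "u \<in> {k}"
      using const w(1) by simp
  next
    fix u
    assume u: "u \<in> {k}"
    have "?A \<noteq> {}"
      using Y_ne unfolding Z_def by (auto simp: PiE_eq_empty_iff)
    then obtain x where x: "x \<in> ?A"
      by blast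
    have "lift x \<zeta>' \<in> level_product \<kappa> \<delta> W"
    proof -
      have "lift x \<zeta>' \<in> (\<Pi>\<^sub>E i\<in>Field \<delta>. level \<kappa> (W i) \<zeta>')"
      proof (rule PiE_I)
        fix i
        assume i: "i \<in> Field \<delta>"
        then have "lift x \<zeta>' i \<in> W i"
          using x unfolding lift_def W_def by auto
        then show "lift x \<zeta>' i \<in> level \<kappa> (W i) \<zeta>'"
          using W_level[OF i] unfolding level_def by blast
      qed (simp add: lift_def)
      then show ?thesis
        unfolding level_product_def using \<zeta>'_Field by blast
    qed
    then show "u \<in> c ` level_product \<kappa> \<delta> W"
      using const[OF x] u by auto
  qed
  then have "card (c ` level_product \<kappa> \<delta> W) = 1"
    by simp
  moreover have "\<zeta> \<in> underS \<kappa> \<zeta>'"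
    using below unfolding L_def by blast
  ultimately show "\<exists>\<zeta>\<in>Field \<kappa>. \<exists>\<zeta>'\<in>Field \<kappa>. \<zeta> \<in> underS \<kappa> \<zeta>' \<and>
      (\<exists>t X. (\<forall>i\<in>Field \<delta>. t i \<in> level \<kappa> (T i) \<zeta>) \<and>
        (\<forall>i\<in>Field \<delta>. X i \<subseteq> level \<kappa> (T i) \<zeta>') \<and>
        (\<forall>i\<in>Field \<delta>. dominates (X i) (level \<kappa> (T i) (ord_suc \<kappa> \<zeta>) \<inter> Cone \<kappa> (t i))) \<and>
        card (c ` level_product \<kappa> \<delta> X) = 1)"
    using \<zeta> \<zeta>'_Field t W_level W_dom unfolding Y_def by blast
qed

end

theorem theorem3p5:
  fixes \<kappa> :: "'a rel" and \<delta> :: "'d rel" and \<sigma> :: "'s rel"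
  assumes "weakly_compact \<kappa>"
    and "Well_order \<delta>" and "\<delta> \<noteq> {}" and "\<delta> <o \<kappa>"
    and "Well_order \<sigma>" and "\<sigma> \<noteq> {}" and "\<sigma> <o \<kappa>"
  shows "SDHL' \<delta> \<sigma> \<kappa> \<longleftrightarrow> SDHL \<delta> \<sigma> \<kappa>"
proof -
  interpret inaccessible \<kappa>
    using assms(1) unfolding weakly_compact_def by unfold_locales blast
  \<comment> \<open>The cardinal of a set is the least well-order on it, so an ordinal below
    \<kappa> has fewer than \<kappa> elements.\<close>
  have "|Field \<delta>| <o \<kappa>"
    using card_of_least[OF assms(2)] assms(4) by (rule ordLeq_ordLess_trans)
  moreover have "|Field \<sigma>| <o \<kappa>"
    using card_of_least[OF assms(5)] assms(7) by (rule ordLeq_ordLess_trans)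
  ultimately show ?thesis
    using SDHL'_imp_SDHL[OF assms(1)] SDHL_imp_SDHL' by metis
qed

end
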